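(* Let $\alpha_1,\alpha_2,\beta_1,\beta_2$ be $4$ arbitrary ($t$-independent) parameters and consider the autonomous system of $2$ nonlinearly-coupled first-order ODEs $$\dot x_1(t)=\frac{x_1(t)+\alpha_1x_2(t)}{\beta_1[x_1(t)]^2+(\alpha_1\beta_1+\alpha_2\beta_2)x_1(t)x_2(t)+\beta_2[x_2(t)]^2},$$ $$\dot x_2(t)=-\frac{x_2(t)+\alpha_2x_1(t)}{\beta_1[x_1(t)]^2+(\alpha_1\beta_1+\alpha_2\beta_2)x_1(t)x_2(t)+\beta_2[x_2(t)]^2}.$$ The solution of the initial-values problem of this system, with initial data $x_1(0),x_2(0)$, reads as follows: $$x_n(t)=\gamma_{n1}\sqrt{1+t/t_1}+\gamma_{n2}\sqrt{1+t/t_2},\qquad n=1,2,$$ with $$\gamma_{11}=\frac{b_2[b_1x_1(0)+a_2x_2(0)]}{b_1b_2-a_1a_2},\qquad \gamma_{22}=\frac{b_1[a_1x_1(0)+b_2x_2(0)]}{b_1b_2-a_1a_2},$$ $$\gamma_{12}=\frac{-a_2[a_1x_1(0)+b_2x_2(0)]}{b_1b_2-a_1a_2},\qquad \gamma_{21}=\frac{-a_1[b_1x_1(0)+a_2x_2(0)]}{b_1b_2-a_1a_2},$$ $$b_1=2\beta_1-\alpha_2(r+\alpha_1\beta_1+\alpha_2\beta_2),\qquad b_2=-2\beta_2+\alpha_1(r+\alpha_1\beta_1+\alpha_2\beta_2),$$ $$a_n=(-1)^{n+1}r+\alpha_1\beta_1-\alpha_2\beta_2,\qquad n=1,2,$$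 $$r=\sqrt{(\alpha_1\beta_1+\alpha_2\beta_2)^2-4\beta_1\beta_2},$$ $$t_1=-\eta/\eta_1,\qquad t_2=\eta/\eta_2,$$ $$\eta=(\gamma_{12}\gamma_{21}-\gamma_{11}\gamma_{22})\left\{\beta_1[x_1(0)]^2+(\alpha_1\beta_1+\alpha_2\beta_2)x_1(0)x_2(0)+\beta_2[x_2(0)]^2\right\},$$ $$\eta_1=2\left[(\alpha_2\gamma_{12}+\gamma_{22})x_1(0)+(\gamma_{12}+\alpha_1\gamma_{22})x_2(0)\right],$$ $$\eta_2=2\left[(\alpha_2\gamma_{11}+\gamma_{21})x_1(0)+(\gamma_{11}+\alpha_1\gamma_{21})x_2(0)\right].$$
   Context: The independent variable is $t$ (one might think of it as time); the superimposed dot denotes differentiation with respect to $t$; $x_1(t),x_2(t)$ are the $2$ dependent variables. Square roots: the formulas give the solution explicitly up to the implicit sign ambiguities due to the square roots appearing in them. With the most obvious assignment of the square roots the solution formulas become identities at $t=0$, and thereafter they define the solution by continuity in $t$. A singularity may be hit if the time evolution causes the argument of one of the $2$ square roots $\sqrt{1+t/t_n}$ ($n=1,2$) to vanish. *)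

theory Defs
  imports "HOL-Analysis.Analysis"
begin

definition quad_form ::
    "complex \<Rightarrow> complex \<Rightarrow> complex \<Rightarrow> complex \<Rightarrow> complex \<Rightarrow> complex \<Rightarrow> complex" where
  "quad_form \<alpha>\<^sub>1 \<alpha>\<^sub>2 \<beta>\<^sub>1 \<beta>\<^sub>2 u v =
     \<beta>\<^sub>1 * u\<^sup>2 + (\<alpha>\<^sub>1 * \<beta>\<^sub>1 + \<alpha>\<^sub>2 * \<beta>\<^sub>2) * u * v + \<beta>\<^sub>2 * v\<^sup>2"

text \<open>Time is real; parameters, initial data and dependent variables are complex. A solution has
  to keep the denominator away from zero, since otherwise the right-hand sides would be read with
  the convention that division by zero gives zero.\<close>

definition solves_ivp ::
    "complex \<Rightarrow> complex \<Rightarrow> complex \<Rightarrow> complex \<Rightarrow> complex \<Rightarrow> complex \<Rightarrow>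
     real set \<Rightarrow> (real \<Rightarrow> complex) \<Rightarrow> (real \<Rightarrow> complex) \<Rightarrow> bool" where
  "solves_ivp \<alpha>\<^sub>1 \<alpha>\<^sub>2 \<beta>\<^sub>1 \<beta>\<^sub>2 u v I x\<^sub>1 x\<^sub>2 \<longleftrightarrow>
     x\<^sub>1 0 = u \<and> x\<^sub>2 0 = v \<and>
     (\<forall>t\<in>I. quad_form \<alpha>\<^sub>1 \<alpha>\<^sub>2 \<beta>\<^sub>1 \<beta>\<^sub>2 (x\<^sub>1 t) (x\<^sub>2 t) \<noteq> 0 \<and>
        (x\<^sub>1 has_vector_derivative
           (x\<^sub>1 t + \<alpha>\<^sub>1 * x\<^sub>2 t) / quad_form \<alpha>\<^sub>1 \<alpha>\<^sub>2 \<beta>\<^sub>1 \<beta>\<^sub>2 (x\<^sub>1 t) (x\<^sub>2 t)) (at t within I) \<and>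
        (x\<^sub>2 has_vector_derivative
           - ((x\<^sub>2 t + \<alpha>\<^sub>2 * x\<^sub>1 t) / quad_form \<alpha>\<^sub>1 \<alpha>\<^sub>2 \<beta>\<^sub>1 \<beta>\<^sub>2 (x\<^sub>1 t) (x\<^sub>2 t))) (at t within I))"

text \<open>The square root of \<open>1 + t / \<tau>\<close> that equals 1 at \<open>t = 0\<close> and is continued from there by
  continuity is the principal one: for real \<open>t\<close> the argument moves along a straight line through 1,
  so it cannot reach the branch cut without first passing through zero. The next three lemmas
  make this precise.\<close>

lemma one_plus_not_nonpos_Reals:
  fixes I :: "real set" and \<tau> :: complex
  assumes I: "is_interval I" "0 \<in> I"
    and nz: "\<forall>t\<in>I. 1 + of_real t / \<tau> \<noteq> 0" and t: "t \<in> I"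
  shows "1 + of_real t / \<tau> \<notin> \<real>\<^sub>\<le>\<^sub>0"
proof
  assume "1 + of_real t / \<tau> \<in> \<real>\<^sub>\<le>\<^sub>0"
  then obtain c where c: "c \<le> 0" "1 + of_real t / \<tau> = of_real c"
    by (auto elim!: nonpos_Reals_cases)
  define k where "k = 1 / (1 - c)"
  have k: "0 \<le> k" "k \<le> 1" "k * (1 - c) = 1"
    using c(1) by (auto simp: k_def)
  have "closed_segment 0 t \<subseteq> I"
    using I t by (simp add: closed_segment_subset is_interval_convex)
  moreover have "k * t \<in> closed_segment 0 t"
    using k by (auto simp: in_segment)
  ultimately have "k * t \<in> I" by blast
  moreover have "of_real t / \<tau> = of_real c - 1"
    using c(2) by (metis add_diff_cancel_left')
  then have "1 + of_real (k * t) / \<tau> = 1 - of_real (k * (1 - c))"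
    by (simp only: of_real_mult times_divide_eq_right[symmetric])
       (simp add: algebra_simps)
  ultimately show False
    using nz k(3) by (metis diff_self of_real_1)
qed

lemma continuous_on_csqrt_one_plus:
  fixes I :: "real set" and \<tau> :: complex
  assumes "is_interval I" "0 \<in> I" "\<forall>t\<in>I. 1 + of_real t / \<tau> \<noteq> 0"
  shows "continuous_on I (\<lambda>t. csqrt (1 + of_real t / \<tau>))"
proof -
  have "continuous_on I (\<lambda>t. 1 + of_real t / \<tau>)"
    by (cases "\<tau> = 0") (auto intro!: continuous_intros)
  then show ?thesis
    by (rule continuous_on_compose2[OF continuous_on_csqrt])
       (use one_plus_not_nonpos_Reals[OF assms] in auto)
qed

lemma csqrt_one_plus_unique:
  fixes I :: "real set" and \<tau> :: complex
  assumes I: "is_interval I" "0 \<in> I" "\<forall>t\<in>I. 1 + of_real t / \<tau> \<noteq> 0"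
    and s: "continuous_on I s" "s 0 = 1" "\<forall>t\<in>I. (s t)\<^sup>2 = 1 + of_real t / \<tau>"
    and t: "t \<in> I"
  shows "s t = csqrt (1 + of_real t / \<tau>)"
proof -
  let ?c = "\<lambda>t::real. csqrt (1 + of_real t / \<tau>)"
  let ?q = "\<lambda>t. s t / ?c t"
  have nz: "?c t \<noteq> 0" if "t \<in> I" for t
    using I(3) that by simp
  have cont: "continuous_on I ?q"
    using s(1) continuous_on_csqrt_one_plus[OF I] nz by (intro continuous_on_divide) auto
  have "(?q t)\<^sup>2 = 1" if "t \<in> I" for t
    using s(3) I(3) that by (simp add: power_divide)
  then have "?q ` I \<subseteq> {1, -1}"
    unfolding power2_eq_1_iff by blast
  then have "finite (?q ` I)"
    using finite_subset by blast
  then have "?q constant_on I"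
    using continuous_finite_range_constant[of I ?q] cont I(1)
    by (simp add: is_interval_connected)
  then obtain y where "\<forall>t\<in>I. ?q t = y"
    by (auto simp: constant_on_def)
  then have "?q t = ?q 0"
    using t I(2) by metis
  then show ?thesis
    using s(2) nz[OF t] by (simp add: field_simps)
qed

end

(*
In the linear coordinates y1 = b1 x1 + a2 x2, y2 = a1 x1 + b2 x2 the quadratic form in the
denominator becomes a multiple of y1 y2, and the system decouples into y1' = c1 / y1 and
y2' = c2 / y2. Hence y1^2 and y2^2 are affine in t, which gives the square roots; continuity along
the interval fixes their branches. The determinant b1 b2 - a1 a2 equals 2 r w m with
w = r + \<alpha>1 \<beta>1 + \<alpha>2 \<beta>2 and m = 1 - \<alpha>1 \<alpha>2, so its being nonzero rules out all degenerate cases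
(in particular t1, t2 are finite and nonzero).
*)
theory Submission
  imports Defs
begin

text \<open>Multiplying \<open>y' = c / y\<close> by \<open>2 * y\<close> gives
  \<open>(y\<^sup>2)' = 2 * c\<close>, so \<open>y\<^sup>2\<close> is affine in \<open>t\<close> and
  only the branch of its root remains to be fixed. The assumption is on \<open>1 / \<tau>\<close> so
  that \<open>c = 0\<close> is covered too: then \<open>\<tau> = 0\<close>,
  \<open>t / \<tau>\<close> is 0 by convention, and the solution is constant.\<close>

lemma scalar_sqrt_ode_iff:
  fixes c y0 :: complex and y :: "real \<Rightarrow> complex"
  assumes I: "is_interval I" "0 \<in> I" and y0: "y0 \<noteq> 0" and \<tau>: "1 / \<tau> = 2 * c / y0\<^sup>2"
  shows "(y 0 = y0 \<and> (\<forall>t\<in>I. y t \<noteq> 0 \<and> (y has_vector_derivative c / y t) (at t within I))) \<longleftrightarrow>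
    (\<forall>t\<in>I. 1 + of_real t / \<tau> \<noteq> 0 \<and> y t = y0 * csqrt (1 + of_real t / \<tau>))"
    (is "?ode \<longleftrightarrow> ?sol")
proof -
  have of_real_der: "(of_real has_vector_derivative (1 :: complex)) (at t within I)" for t
    using has_vector_derivative_of_real[OF DERIV_ident] by simp
  have quot: "of_real t / \<tau> = 2 * c * of_real t / y0\<^sup>2" for t
    using arg_cong[OF \<tau>, of "\<lambda>z. of_real t * z"] by simp
  show ?thesis
  proof
    assume ode: ?ode
    then have der: "(y has_vector_derivative c / y t) (at t within I)" and nz: "y t \<noteq> 0"
      if "t \<in> I" for t using that by auto
    have "((\<lambda>t. (y t)\<^sup>2 - 2 * c * of_real t) has_vector_derivative 0) (at t within I)"
      if "t \<in> I" for t
    proof -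
      have "((\<lambda>t. y t * y t - 2 * c * of_real t) has_vector_derivative
          (y t * (c / y t) + c / y t * y t) - 2 * c * 1) (at t within I)"
        by (intro has_vector_derivative_diff has_vector_derivative_mult der that
            has_vector_derivative_mult_right of_real_der)
      then show ?thesis
        using nz[OF that] by (simp add: power2_eq_square)
    qed
    then obtain k where k: "(y t)\<^sup>2 - 2 * c * of_real t = k" if "t \<in> I" for t
      using has_vector_derivative_zero_constant[OF is_interval_convex[OF I(1)],
          where f = "\<lambda>t. (y t)\<^sup>2 - 2 * c * of_real t"] by blast
    have sq: "(y t)\<^sup>2 = y0\<^sup>2 * (1 + of_real t / \<tau>)" if "t \<in> I" for t
    proof -
      have "k = y0\<^sup>2" using k[OF I(2)] ode by simp
      then have "(y t)\<^sup>2 = y0\<^sup>2 + 2 * c * of_real t" using k[OF that] by (simp add: algebra_simps)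
      then show ?thesis using y0 by (simp add: quot distrib_left)
    qed
    \<comment> \<open>A zero of the radicand would be a zero of \<open>y\<close>, which the equation
      excludes.\<close>
    have nz': "\<forall>t\<in>I. 1 + of_real t / \<tau> \<noteq> 0"
      using sq nz by (metis mult_zero_right power_eq_0_iff)
    have "continuous_on I y"
      using der has_vector_derivative_continuous continuous_on_eq_continuous_within by blast
    \<comment> \<open>The quotient \<open>y / y0\<close> is a continuous square root of the radicand
      with value 1 at 0, hence the principal one.\<close>
    then have "y t / y0 = csqrt (1 + of_real t / \<tau>)" if "t \<in> I" for t
      using ode y0 sq that
      by (intro csqrt_one_plus_unique[OF I nz', where s = "\<lambda>t. y t / y0"])
        (auto intro!: continuous_intros simp: power_divide)
    then show ?sol
      using nz' y0 by (simp add: field_simps)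
  next
    assume sol: ?sol
    then have nz: "\<forall>t\<in>I. 1 + of_real t / \<tau> \<noteq> 0" by blast
    have "(y has_vector_derivative c / y t) (at t within I)" if t: "t \<in> I" for t
    proof -
      let ?w = "1 + of_real t / \<tau>"
      \<comment> \<open>Writing the quotient as a product with \<open>1 / \<tau>\<close> avoids a
        case split on \<open>\<tau> = 0\<close>.\<close>
      have "((\<lambda>t. 1 + of_real t * (1 / \<tau>)) has_vector_derivative 0 + 1 * (1 / \<tau>)) (at t within I)"
        by (intro has_vector_derivative_add has_vector_derivative_const
            has_vector_derivative_mult_left of_real_der)
      then have inner: "((\<lambda>t. 1 + of_real t / \<tau>) has_vector_derivative 1 / \<tau>) (at t within I)"
        by simp
      have "(csqrt has_field_derivative inverse (2 * csqrt ?w)) (at ?w)"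
        by (rule has_field_derivative_csqrt) (rule one_plus_not_nonpos_Reals[OF I nz t])
      from field_vector_diff_chain_within[OF inner has_field_derivative_at_within[OF this]]
      have "((\<lambda>t. y0 * csqrt (1 + of_real t / \<tau>)) has_vector_derivative
          y0 * (1 / \<tau> * inverse (2 * csqrt ?w))) (at t within I)"
        by (intro has_vector_derivative_mult_right) (simp add: o_def)
      moreover have "y0 * (1 / \<tau> * inverse (2 * csqrt ?w)) = c / y t"
        unfolding \<tau> using sol t y0 by (simp add: field_simps power2_eq_square)
      ultimately show ?thesis
        using sol t by (auto intro: has_vector_derivative_transform)
    qed
    then show ?ode
      using sol I(2) y0 by auto
  qed
qed

text \<open>Only \<open>r\<^sup>2\<close> is prescribed, so these hold for either sign of the root.
  The last two show that the new coordinates swap the numerators: the first image is a multiple of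
  the second coordinate and vice versa. Division by the product of both coordinates then leaves a
  constant over a single one. Keeping \<open>w\<close> on the left makes them polynomial
  identities.\<close>

lemma coordinate_identities:
  fixes \<alpha>\<^sub>1 \<alpha>\<^sub>2 \<beta>\<^sub>1 \<beta>\<^sub>2 r x z :: complex
  defines "w \<equiv> r + \<alpha>\<^sub>1 * \<beta>\<^sub>1 + \<alpha>\<^sub>2 * \<beta>\<^sub>2" and "m \<equiv> 1 - \<alpha>\<^sub>1 * \<alpha>\<^sub>2"
  assumes r: "r\<^sup>2 = (\<alpha>\<^sub>1 * \<beta>\<^sub>1 + \<alpha>\<^sub>2 * \<beta>\<^sub>2)\<^sup>2 - 4 * \<beta>\<^sub>1 * \<beta>\<^sub>2"
    and b\<^sub>1: "b\<^sub>1 = 2 * \<beta>\<^sub>1 - \<alpha>\<^sub>2 * (r + \<alpha>\<^sub>1 * \<beta>\<^sub>1 + \<alpha>\<^sub>2 * \<beta>\<^sub>2)"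
    and b\<^sub>2: "b\<^sub>2 = - 2 * \<beta>\<^sub>2 + \<alpha>\<^sub>1 * (r + \<alpha>\<^sub>1 * \<beta>\<^sub>1 + \<alpha>\<^sub>2 * \<beta>\<^sub>2)"
    and a\<^sub>1: "a\<^sub>1 = r + \<alpha>\<^sub>1 * \<beta>\<^sub>1 - \<alpha>\<^sub>2 * \<beta>\<^sub>2"
    and a\<^sub>2: "a\<^sub>2 = - r + \<alpha>\<^sub>1 * \<beta>\<^sub>1 - \<alpha>\<^sub>2 * \<beta>\<^sub>2"
  shows diagonal_product: "b\<^sub>1 * b\<^sub>2 = w\<^sup>2 * m"
    and coordinate_det: "b\<^sub>1 * b\<^sub>2 - a\<^sub>1 * a\<^sub>2 = 2 * r * w * m"
    and quad_form_factor: "(b\<^sub>1 * x + a\<^sub>2 * z) * (a\<^sub>1 * x + b\<^sub>2 * z) =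
      2 * w * m * quad_form \<alpha>\<^sub>1 \<alpha>\<^sub>2 \<beta>\<^sub>1 \<beta>\<^sub>2 x z"
    and first_coordinate_image:
      "w * (b\<^sub>1 * (x + \<alpha>\<^sub>1 * z) - a\<^sub>2 * (z + \<alpha>\<^sub>2 * x)) = b\<^sub>1 * (a\<^sub>1 * x + b\<^sub>2 * z)"
    and second_coordinate_image:
      "w * (a\<^sub>1 * (x + \<alpha>\<^sub>1 * z) - b\<^sub>2 * (z + \<alpha>\<^sub>2 * x)) = b\<^sub>2 * (b\<^sub>1 * x + a\<^sub>2 * z)"
proof -
  show bb: "b\<^sub>1 * b\<^sub>2 = w\<^sup>2 * m"
    unfolding b\<^sub>1 b\<^sub>2 w_def m_def using r by algebra
  show "b\<^sub>1 * b\<^sub>2 - a\<^sub>1 * a\<^sub>2 = 2 * r * w * m"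
    unfolding b\<^sub>1 b\<^sub>2 a\<^sub>1 a\<^sub>2 w_def m_def using r by algebra
  \<comment> \<open>The coefficients of \<open>x\<^sup>2\<close>, \<open>z\<^sup>2\<close> and
    \<open>x * z\<close> in the product of the two linear forms.\<close>
  have aa: "b\<^sub>1 * a\<^sub>1 = 2 * \<beta>\<^sub>1 * w * m" "b\<^sub>2 * a\<^sub>2 = 2 * \<beta>\<^sub>2 * w * m"
    "b\<^sub>1 * b\<^sub>2 + a\<^sub>1 * a\<^sub>2 = 2 * w * m * (\<alpha>\<^sub>1 * \<beta>\<^sub>1 + \<alpha>\<^sub>2 * \<beta>\<^sub>2)"
    unfolding b\<^sub>1 b\<^sub>2 a\<^sub>1 a\<^sub>2 w_def m_def using r by algebra+
  \<comment> \<open>The coefficients of \<open>x\<close> and \<open>z\<close> in the images of the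
    numerators; times \<open>w\<close> they become products already computed in \<open>aa\<close>
    and \<open>bb\<close>.\<close>
  have rows: "b\<^sub>1 - a\<^sub>2 * \<alpha>\<^sub>2 = 2 * \<beta>\<^sub>1 * m" "b\<^sub>1 * \<alpha>\<^sub>1 - a\<^sub>2 = w * m"
    "a\<^sub>1 - b\<^sub>2 * \<alpha>\<^sub>2 = w * m" "a\<^sub>1 * \<alpha>\<^sub>1 - b\<^sub>2 = 2 * \<beta>\<^sub>2 * m"
    unfolding b\<^sub>1 b\<^sub>2 a\<^sub>1 a\<^sub>2 w_def m_def by algebra+
  show "(b\<^sub>1 * x + a\<^sub>2 * z) * (a\<^sub>1 * x + b\<^sub>2 * z) = 2 * w * m * quad_form \<alpha>\<^sub>1 \<alpha>\<^sub>2 \<beta>\<^sub>1 \<beta>\<^sub>2 x z"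
    unfolding quad_form_def using aa by algebra
  show "w * (b\<^sub>1 * (x + \<alpha>\<^sub>1 * z) - a\<^sub>2 * (z + \<alpha>\<^sub>2 * x)) = b\<^sub>1 * (a\<^sub>1 * x + b\<^sub>2 * z)"
    using aa rows bb by algebra
  show "w * (a\<^sub>1 * (x + \<alpha>\<^sub>1 * z) - b\<^sub>2 * (z + \<alpha>\<^sub>2 * x)) = b\<^sub>2 * (b\<^sub>1 * x + a\<^sub>2 * z)"
    using aa rows bb by algebra
qed

text \<open>The equivalence gives existence from right to left and uniqueness from left to right, on
  any interval around or starting at time 0. The conditions on the radicands exclude the times at
  which a singularity is hit.\<close>

theorem mainTheorem1:
  fixes \<alpha>\<^sub>1 \<alpha>\<^sub>2 \<beta>\<^sub>1 \<beta>\<^sub>2 u v r b\<^sub>1 b\<^sub>2 a\<^sub>1 a\<^sub>2 :: complex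
    and \<gamma>\<^sub>1\<^sub>1 \<gamma>\<^sub>1\<^sub>2 \<gamma>\<^sub>2\<^sub>1 \<gamma>\<^sub>2\<^sub>2 \<eta> \<eta>\<^sub>1 \<eta>\<^sub>2 t\<^sub>1 t\<^sub>2 :: complex
    and I :: "real set"
    and x\<^sub>1 x\<^sub>2 :: "real \<Rightarrow> complex"
  assumes "r\<^sup>2 = (\<alpha>\<^sub>1 * \<beta>\<^sub>1 + \<alpha>\<^sub>2 * \<beta>\<^sub>2)\<^sup>2 - 4 * \<beta>\<^sub>1 * \<beta>\<^sub>2"
    and "b\<^sub>1 = 2 * \<beta>\<^sub>1 - \<alpha>\<^sub>2 * (r + \<alpha>\<^sub>1 * \<beta>\<^sub>1 + \<alpha>\<^sub>2 * \<beta>\<^sub>2)"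
    and "b\<^sub>2 = - 2 * \<beta>\<^sub>2 + \<alpha>\<^sub>1 * (r + \<alpha>\<^sub>1 * \<beta>\<^sub>1 + \<alpha>\<^sub>2 * \<beta>\<^sub>2)"
    and "a\<^sub>1 = r + \<alpha>\<^sub>1 * \<beta>\<^sub>1 - \<alpha>\<^sub>2 * \<beta>\<^sub>2"
    and "a\<^sub>2 = - r + \<alpha>\<^sub>1 * \<beta>\<^sub>1 - \<alpha>\<^sub>2 * \<beta>\<^sub>2"
    and "\<gamma>\<^sub>1\<^sub>1 = b\<^sub>2 * (b\<^sub>1 * u + a\<^sub>2 * v) / (b\<^sub>1 * b\<^sub>2 - a\<^sub>1 * a\<^sub>2)"
    and "\<gamma>\<^sub>2\<^sub>2 = b\<^sub>1 * (a\<^sub>1 * u + b\<^sub>2 * v) / (b\<^sub>1 * b\<^sub>2 - a\<^sub>1 * a\<^sub>2)"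
    and "\<gamma>\<^sub>1\<^sub>2 = - a\<^sub>2 * (a\<^sub>1 * u + b\<^sub>2 * v) / (b\<^sub>1 * b\<^sub>2 - a\<^sub>1 * a\<^sub>2)"
    and "\<gamma>\<^sub>2\<^sub>1 = - a\<^sub>1 * (b\<^sub>1 * u + a\<^sub>2 * v) / (b\<^sub>1 * b\<^sub>2 - a\<^sub>1 * a\<^sub>2)"
    and "\<eta> = (\<gamma>\<^sub>1\<^sub>2 * \<gamma>\<^sub>2\<^sub>1 - \<gamma>\<^sub>1\<^sub>1 * \<gamma>\<^sub>2\<^sub>2) * quad_form \<alpha>\<^sub>1 \<alpha>\<^sub>2 \<beta>\<^sub>1 \<beta>\<^sub>2 u v"
    and "\<eta>\<^sub>1 = 2 * ((\<alpha>\<^sub>2 * \<gamma>\<^sub>1\<^sub>2 + \<gamma>\<^sub>2\<^sub>2) * u + (\<gamma>\<^sub>1\<^sub>2 + \<alpha>\<^sub>1 * \<gamma>\<^sub>2\<^sub>2) * v)"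
    and "\<eta>\<^sub>2 = 2 * ((\<alpha>\<^sub>2 * \<gamma>\<^sub>1\<^sub>1 + \<gamma>\<^sub>2\<^sub>1) * u + (\<gamma>\<^sub>1\<^sub>1 + \<alpha>\<^sub>1 * \<gamma>\<^sub>2\<^sub>1) * v)"
    and "t\<^sub>1 = - \<eta> / \<eta>\<^sub>1"
    and "t\<^sub>2 = \<eta> / \<eta>\<^sub>2"
    and "b\<^sub>1 * b\<^sub>2 - a\<^sub>1 * a\<^sub>2 \<noteq> 0"
    and "quad_form \<alpha>\<^sub>1 \<alpha>\<^sub>2 \<beta>\<^sub>1 \<beta>\<^sub>2 u v \<noteq> 0"
    and "is_interval I" "0 \<in> I"
  shows "solves_ivp \<alpha>\<^sub>1 \<alpha>\<^sub>2 \<beta>\<^sub>1 \<beta>\<^sub>2 u v I x\<^sub>1 x\<^sub>2 \<longleftrightarrow>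
    (\<forall>t\<in>I. 1 + of_real t / t\<^sub>1 \<noteq> 0 \<and> 1 + of_real t / t\<^sub>2 \<noteq> 0 \<and>
       x\<^sub>1 t = \<gamma>\<^sub>1\<^sub>1 * csqrt (1 + of_real t / t\<^sub>1) + \<gamma>\<^sub>1\<^sub>2 * csqrt (1 + of_real t / t\<^sub>2) \<and>
       x\<^sub>2 t = \<gamma>\<^sub>2\<^sub>1 * csqrt (1 + of_real t / t\<^sub>1) + \<gamma>\<^sub>2\<^sub>2 * csqrt (1 + of_real t / t\<^sub>2))"
proof -
  define w where "w = r + \<alpha>\<^sub>1 * \<beta>\<^sub>1 + \<alpha>\<^sub>2 * \<beta>\<^sub>2"
  define m where "m = 1 - \<alpha>\<^sub>1 * \<alpha>\<^sub>2"
  define D where "D = b\<^sub>1 * b\<^sub>2 - a\<^sub>1 * a\<^sub>2"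
  let ?Q = "quad_form \<alpha>\<^sub>1 \<alpha>\<^sub>2 \<beta>\<^sub>1 \<beta>\<^sub>2"
  let ?Y = "\<lambda>x z. b\<^sub>1 * x + a\<^sub>2 * z" and ?Z = "\<lambda>x z. a\<^sub>1 * x + b\<^sub>2 * z"
  let ?F = "\<lambda>x z. (x + \<alpha>\<^sub>1 * z) / ?Q x z" and ?G = "\<lambda>x z. - ((z + \<alpha>\<^sub>2 * x) / ?Q x z)"
  define p q where "p = ?Y u v" and "q = ?Z u v"
  note ids = coordinate_identities[OF assms(1-5), folded w_def m_def]
  have D: "D \<noteq> 0" using assms(15) by (simp add: D_def)
  then have wm: "w \<noteq> 0" "m \<noteq> 0" using ids(2) by (auto simp: D_def)
  \<comment> \<open>With \<open>m\<close> nonzero this makes the constants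
    \<open>2 * m * b\<^sub>1\<close> and \<open>2 * m * b\<^sub>2\<close> of the scalar equations
    nonzero.\<close>
  then have b: "b\<^sub>1 \<noteq> 0" "b\<^sub>2 \<noteq> 0" using ids(1) by auto
  have Q_iff: "?Q x z \<noteq> 0 \<longleftrightarrow> ?Y x z \<noteq> 0 \<and> ?Z x z \<noteq> 0" for x z
    using ids(3)[of x z] wm by (metis mult_eq_0_iff zero_neq_numeral)
  then have pq: "p \<noteq> 0" "q \<noteq> 0" using assms(16) by (auto simp: p_def q_def)

  \<comment> \<open>The vector field in the new coordinates\<close>
  have field: "b\<^sub>1 * ?F x z + a\<^sub>2 * ?G x z = 2 * m * b\<^sub>1 / ?Y x z"
    "a\<^sub>1 * ?F x z + b\<^sub>2 * ?G x z = 2 * m * b\<^sub>2 / ?Z x z" if "?Q x z \<noteq> 0" for x z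
  proof -
    have nz: "?Y x z \<noteq> 0" "?Z x z \<noteq> 0" using that Q_iff by auto
    \<comment> \<open>Here \<open>h\<close> is the image of the numerators and \<open>k\<close> is
      \<open>b\<^sub>1\<close> or \<open>b\<^sub>2\<close>; the second use exchanges the roles of
      \<open>Y\<close> and \<open>Z\<close>.\<close>
    have *: "h / ?Q x z = k * 2 * m / Y"
      if "w * h = k * Z" "Y * Z = 2 * w * m * ?Q x z" "Y \<noteq> 0" for h k Y Z
    proof -
      have "w * (h * Y) = w * (k * 2 * m * ?Q x z)" using that(1,2) by algebra
      then show ?thesis using wm that(3) \<open>?Q x z \<noteq> 0\<close> by (simp add: frac_eq_eq)
    qed
    show "b\<^sub>1 * ?F x z + a\<^sub>2 * ?G x z = 2 * m * b\<^sub>1 / ?Y x z"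
      using *[OF ids(4)[of x z] ids(3)[of x z] nz(1)]
      by (simp add: diff_divide_distrib mult_ac)
    show "a\<^sub>1 * ?F x z + b\<^sub>2 * ?G x z = 2 * m * b\<^sub>2 / ?Z x z"
      using *[OF ids(5)[of x z] _ nz(2)] ids(3)[of x z]
      by (simp add: diff_divide_distrib mult_ac)
  qed

  \<comment> \<open>Inverting the coordinate change by Cramer's rule\<close>
  have inv: "x = (b\<^sub>2 * Y - a\<^sub>2 * Z) / D \<and> z = (b\<^sub>1 * Z - a\<^sub>1 * Y) / D \<longleftrightarrow> ?Y x z = Y \<and> ?Z x z = Z"
    for x z Y Z
  proof -
    have "x = (b\<^sub>2 * Y - a\<^sub>2 * Z) / D \<and> z = (b\<^sub>1 * Z - a\<^sub>1 * Y) / D \<longleftrightarrow>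
        x * D = b\<^sub>2 * Y - a\<^sub>2 * Z \<and> z * D = b\<^sub>1 * Z - a\<^sub>1 * Y"
      using D by (simp add: eq_divide_eq)
    also have "\<dots> \<longleftrightarrow> ?Y x z = Y \<and> ?Z x z = Z"
    proof
      assume "x * D = b\<^sub>2 * Y - a\<^sub>2 * Z \<and> z * D = b\<^sub>1 * Z - a\<^sub>1 * Y"
      then have "D * ?Y x z = D * Y" "D * ?Z x z = D * Z"
        unfolding D_def by algebra+
      then show "?Y x z = Y \<and> ?Z x z = Z" using D by simp
    qed (auto simp: D_def algebra_simps)
    finally show ?thesis .
  qed
  define y\<^sub>1 y\<^sub>2 where "y\<^sub>1 = (\<lambda>t. ?Y (x\<^sub>1 t) (x\<^sub>2 t))" and "y\<^sub>2 = (\<lambda>t. ?Z (x\<^sub>1 t) (x\<^sub>2 t))"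
  have x_eq: "x\<^sub>1 = (\<lambda>t. (b\<^sub>2 * y\<^sub>1 t - a\<^sub>2 * y\<^sub>2 t) / D)" "x\<^sub>2 = (\<lambda>t. (b\<^sub>1 * y\<^sub>2 t - a\<^sub>1 * y\<^sub>1 t) / D)"
    using inv unfolding y\<^sub>1_def y\<^sub>2_def by blast+
  \<comment> \<open>Differentiation commutes with the constant linear map and with its inverse, so
    derivatives transfer both ways.\<close>
  have der_iff: "(x\<^sub>1 has_vector_derivative f) (at t within I) \<and>
      (x\<^sub>2 has_vector_derivative g) (at t within I) \<longleftrightarrow>
      (y\<^sub>1 has_vector_derivative ?Y f g) (at t within I) \<and>
      (y\<^sub>2 has_vector_derivative ?Z f g) (at t within I)" for f g t
  proof
    assume "(x\<^sub>1 has_vector_derivative f) (at t within I) \<and>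
      (x\<^sub>2 has_vector_derivative g) (at t within I)"
    then show "(y\<^sub>1 has_vector_derivative ?Y f g) (at t within I) \<and>
      (y\<^sub>2 has_vector_derivative ?Z f g) (at t within I)"
      unfolding y\<^sub>1_def y\<^sub>2_def
      by (auto intro!: has_vector_derivative_add has_vector_derivative_mult_right)
  next
    assume "(y\<^sub>1 has_vector_derivative ?Y f g) (at t within I) \<and>
      (y\<^sub>2 has_vector_derivative ?Z f g) (at t within I)"
    then have "(x\<^sub>1 has_vector_derivative (b\<^sub>2 * ?Y f g - a\<^sub>2 * ?Z f g) / D) (at t within I) \<and>
      (x\<^sub>2 has_vector_derivative (b\<^sub>1 * ?Z f g - a\<^sub>1 * ?Y f g) / D) (at t within I)"
      unfolding x_eq
      by (auto intro!: has_vector_derivative_divide has_vector_derivative_diff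
          has_vector_derivative_mult_right)
    moreover have "f = (b\<^sub>2 * ?Y f g - a\<^sub>2 * ?Z f g) / D" "g = (b\<^sub>1 * ?Z f g - a\<^sub>1 * ?Y f g) / D"
      using inv by blast+
    ultimately show "(x\<^sub>1 has_vector_derivative f) (at t within I) \<and>
      (x\<^sub>2 has_vector_derivative g) (at t within I)" by metis
  qed
  have init: "x\<^sub>1 0 = u \<and> x\<^sub>2 0 = v \<longleftrightarrow> y\<^sub>1 0 = p \<and> y\<^sub>2 0 = q"
    using inv[of u p q v] inv[of "x\<^sub>1 0" p q "x\<^sub>2 0"] by (auto simp: p_def q_def y\<^sub>1_def y\<^sub>2_def)

  \<comment> \<open>Decoupling into two scalar problems\<close>
  have "solves_ivp \<alpha>\<^sub>1 \<alpha>\<^sub>2 \<beta>\<^sub>1 \<beta>\<^sub>2 u v I x\<^sub>1 x\<^sub>2 \<longleftrightarrow>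
      (y\<^sub>1 0 = p \<and> y\<^sub>2 0 = q) \<and> (\<forall>t\<in>I. (y\<^sub>1 t \<noteq> 0 \<and> y\<^sub>2 t \<noteq> 0) \<and>
        (y\<^sub>1 has_vector_derivative 2 * m * b\<^sub>1 / y\<^sub>1 t) (at t within I) \<and>
        (y\<^sub>2 has_vector_derivative 2 * m * b\<^sub>2 / y\<^sub>2 t) (at t within I))"
  proof -
    have "?Q (x\<^sub>1 t) (x\<^sub>2 t) \<noteq> 0 \<and>
        (x\<^sub>1 has_vector_derivative ?F (x\<^sub>1 t) (x\<^sub>2 t)) (at t within I) \<and>
        (x\<^sub>2 has_vector_derivative ?G (x\<^sub>1 t) (x\<^sub>2 t)) (at t within I) \<longleftrightarrow>
      (y\<^sub>1 t \<noteq> 0 \<and> y\<^sub>2 t \<noteq> 0) \<and>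
        (y\<^sub>1 has_vector_derivative 2 * m * b\<^sub>1 / y\<^sub>1 t) (at t within I) \<and>
        (y\<^sub>2 has_vector_derivative 2 * m * b\<^sub>2 / y\<^sub>2 t) (at t within I)" for t
    \<comment> \<open>If the form vanishes, so does one of the coordinates and both sides are false;
      otherwise \<open>field\<close> applies.\<close>
    proof (cases "?Q (x\<^sub>1 t) (x\<^sub>2 t) = 0")
      case True
      then show ?thesis using Q_iff[of "x\<^sub>1 t" "x\<^sub>2 t"] by (auto simp: y\<^sub>1_def y\<^sub>2_def)
    next
      case False
      then show ?thesis
        unfolding der_iff field[OF False] using Q_iff[of "x\<^sub>1 t" "x\<^sub>2 t"]
        by (simp add: y\<^sub>1_def y\<^sub>2_def)
    qed
    then show ?thesis
      unfolding solves_ivp_def using init by blast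
  qed
  also have "\<dots> \<longleftrightarrow>
      (y\<^sub>1 0 = p \<and> (\<forall>t\<in>I. y\<^sub>1 t \<noteq> 0 \<and> (y\<^sub>1 has_vector_derivative 2 * m * b\<^sub>1 / y\<^sub>1 t) (at t within I))) \<and>
      (y\<^sub>2 0 = q \<and> (\<forall>t\<in>I. y\<^sub>2 t \<noteq> 0 \<and> (y\<^sub>2 has_vector_derivative 2 * m * b\<^sub>2 / y\<^sub>2 t) (at t within I)))"
    by blast

  \<comment> \<open>Solving the scalar problems and identifying the time constants\<close>
  also have "\<dots> \<longleftrightarrow>
      (\<forall>t\<in>I. 1 + of_real t / t\<^sub>1 \<noteq> 0 \<and> y\<^sub>1 t = p * csqrt (1 + of_real t / t\<^sub>1)) \<and>
      (\<forall>t\<in>I. 1 + of_real t / t\<^sub>2 \<noteq> 0 \<and> y\<^sub>2 t = q * csqrt (1 + of_real t / t\<^sub>2))"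
  proof -
    let ?q = "?Q u v"
    have \<gamma>: "\<gamma>\<^sub>1\<^sub>1 = b\<^sub>2 * p / D" "\<gamma>\<^sub>2\<^sub>2 = b\<^sub>1 * q / D" "\<gamma>\<^sub>1\<^sub>2 = - a\<^sub>2 * q / D" "\<gamma>\<^sub>2\<^sub>1 = - a\<^sub>1 * p / D"
      unfolding assms(6-9) p_def q_def D_def by simp_all
    \<comment> \<open>Numerator of the determinant of the \<gamma> coefficients; over the common
      denominator \<open>D * D\<close> it leaves \<open>- (p * q) / D\<close>.\<close>
    have "(- a\<^sub>2 * q) * (- a\<^sub>1 * p) - (b\<^sub>2 * p) * (b\<^sub>1 * q) = - (p * q) * D"
      unfolding D_def by algebra
    then have \<eta>: "\<eta> = - (p * q * ?q / D)"
      unfolding assms(10) \<gamma> times_divide_times_eq diff_divide_distrib[symmetric]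
      using D by simp
    have Q0: "?q \<noteq> 0" by (rule assms(16))
    \<comment> \<open>The numerators at time 0 are written as vector field times form, so that
      \<open>field\<close> evaluates them.\<close>
    have "b\<^sub>1 * (u + \<alpha>\<^sub>1 * v) - a\<^sub>2 * (v + \<alpha>\<^sub>2 * u) = (b\<^sub>1 * ?F u v + a\<^sub>2 * ?G u v) * ?q"
      "a\<^sub>1 * (u + \<alpha>\<^sub>1 * v) - b\<^sub>2 * (v + \<alpha>\<^sub>2 * u) = (a\<^sub>1 * ?F u v + b\<^sub>2 * ?G u v) * ?q"
      using Q0 by (simp_all add: left_diff_distrib)
    then have F: "b\<^sub>1 * (u + \<alpha>\<^sub>1 * v) - a\<^sub>2 * (v + \<alpha>\<^sub>2 * u) = 2 * m * b\<^sub>1 * ?q / p"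
      "a\<^sub>1 * (u + \<alpha>\<^sub>1 * v) - b\<^sub>2 * (v + \<alpha>\<^sub>2 * u) = 2 * m * b\<^sub>2 * ?q / q"
      unfolding field[OF Q0, folded p_def q_def] by simp_all
    \<comment> \<open>Regrouping by \<gamma> shows the numerators
      \<open>u + \<alpha>\<^sub>1 * v\<close> and \<open>v + \<alpha>\<^sub>2 * u\<close>. The image
      appears with a plus sign here and a minus sign in \<open>\<eta>\<^sub>2\<close>, which matches
      the opposite signs in \<open>t\<^sub>1\<close> and \<open>t\<^sub>2\<close>.\<close>
    have "\<eta>\<^sub>1 = 2 * q / D * (b\<^sub>1 * (u + \<alpha>\<^sub>1 * v) - a\<^sub>2 * (v + \<alpha>\<^sub>2 * u))"
      unfolding assms(11) \<gamma> using D by (simp add: field_simps)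
    then have \<eta>\<^sub>1: "\<eta>\<^sub>1 = 2 * q / D * (2 * m * b\<^sub>1 * ?q / p)" unfolding F .
    have "\<eta>\<^sub>2 = - (2 * p / D) * (a\<^sub>1 * (u + \<alpha>\<^sub>1 * v) - b\<^sub>2 * (v + \<alpha>\<^sub>2 * u))"
      unfolding assms(12) \<gamma> using D by (simp add: field_simps)
    then have \<eta>\<^sub>2: "\<eta>\<^sub>2 = - (2 * p / D) * (2 * m * b\<^sub>2 * ?q / q)" unfolding F .
    \<comment> \<open>This is the form required by \<open>scalar_sqrt_ode_iff\<close> with
      \<open>c = 2 * m * b\<^sub>1\<close> and \<open>y0 = p\<close>.\<close>
    have t\<^sub>1: "1 / t\<^sub>1 = 2 * (2 * m * b\<^sub>1) / p\<^sup>2"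
      unfolding assms(13) \<eta> \<eta>\<^sub>1 using D Q0 pq wm b by (simp add: field_simps power2_eq_square)
    have t\<^sub>2: "1 / t\<^sub>2 = 2 * (2 * m * b\<^sub>2) / q\<^sup>2"
      unfolding assms(14) \<eta> \<eta>\<^sub>2 using D Q0 pq wm b by (simp add: field_simps power2_eq_square)
    show ?thesis
      unfolding scalar_sqrt_ode_iff[OF assms(17,18) pq(1) t\<^sub>1]
        scalar_sqrt_ode_iff[OF assms(17,18) pq(2) t\<^sub>2] ..
  qed

  \<comment> \<open>Return to the original variables\<close>
  also have "\<dots> \<longleftrightarrow> (\<forall>t\<in>I. 1 + of_real t / t\<^sub>1 \<noteq> 0 \<and> 1 + of_real t / t\<^sub>2 \<noteq> 0 \<and>
       x\<^sub>1 t = \<gamma>\<^sub>1\<^sub>1 * csqrt (1 + of_real t / t\<^sub>1) + \<gamma>\<^sub>1\<^sub>2 * csqrt (1 + of_real t / t\<^sub>2) \<and>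
       x\<^sub>2 t = \<gamma>\<^sub>2\<^sub>1 * csqrt (1 + of_real t / t\<^sub>1) + \<gamma>\<^sub>2\<^sub>2 * csqrt (1 + of_real t / t\<^sub>2))"
  proof -
    \<comment> \<open>The \<gamma> coefficients are what Cramer's rule yields for the coordinates
      \<open>p * R\<close> and \<open>q * S\<close>, with \<open>R\<close> and \<open>S\<close>
      standing for the two square roots.\<close>
    have "\<gamma>\<^sub>1\<^sub>1 * R + \<gamma>\<^sub>1\<^sub>2 * S = (b\<^sub>2 * (p * R) - a\<^sub>2 * (q * S)) / D"
      "\<gamma>\<^sub>2\<^sub>1 * R + \<gamma>\<^sub>2\<^sub>2 * S = (b\<^sub>1 * (q * S) - a\<^sub>1 * (p * R)) / D" for R S
      unfolding assms(6-9) p_def[symmetric] q_def[symmetric] D_def[symmetric]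
      by (simp_all add: diff_divide_distrib mult.assoc)
    then show ?thesis
      unfolding y\<^sub>1_def y\<^sub>2_def by (auto simp: inv)
  qed
  finally show ?thesis .
qed

end
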